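(* Let $\gamma=\gamma(s):I\to\mathbb{E}^{m+1}$ be a regular generic curve, parametrized by arc length $s$ on an interval $I\subseteq\mathbb{R}$, and let $C_\gamma: s\mapsto C_\gamma(s)$ be the focal representation (focal curve) of $\gamma$. Then the following statements hold: (i) If $\gamma$ is a $1$-slant helix, then $C_\gamma$ is an $(m+1)$-slant helix in $\mathbb{E}^{m+1}$. (ii) If $\gamma$ is an $(m+1)$-slant helix, then $C_\gamma$ is a $1$-slant helix in $\mathbb{E}^{m+1}$. (iii) If $\gamma$ is a $k$-slant helix with $2\le k\le m$, then $C_\gamma$ is an $(m-k+2)$-slant helix in $\mathbb{E}^{m+1}$.
   Context: $\mathbb{E}^{m+1}$ is Euclidean $(m+1)$-space with inner product $\langle\cdot,\cdot\rangle$; curves are smooth. Generic curve: a regular curve $\gamma:I\to\mathbb{E}^{m+1}$ (i.e. $\gamma'(s)\ne 0$ everywhere) is generic (a Frenet curve of osculating order $m+1$) if $\gamma'(s),\gamma''(s),\ldots,\gamma^{(m+1)}(s)$ are linearly independent for every $s\in I$. Frenet frame of $\gamma$: the orthonormal frame $V_1=t,\ V_2=n_1,\ \ldots,\ V_{m+1}=n_m$ along $\gamma$ obtained by applying Gram-Schmidt orthonormalization to $\gamma'(s),\ldots,\gamma^{(m+1)}(s)$. The Frenet curvatures $\kappa_1,\ldots,\kappa_m$ are the functions with $t'=\kappa_1n_1$, $n_i'=-\kappa_i n_{i-1}+\kappa_{i+1}n_{i+1}$ for $1\le i\le m-1$ (with $n_0=t$), and $n_m'=-\kappa_m n_{m-1}$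 (for arc length parameter). Focal curve: $C_\gamma(s)$ is the center of the osculating hypersphere of $\gamma$ at $\gamma(s)$. This center lies in the hyperplane normal to $\gamma$ at $\gamma(s)$, so $C_\gamma=\gamma+c_1n_1+\cdots+c_mn_m$ with smooth functions $c_1,\ldots,c_m$ (the focal curvatures of $\gamma$). Frenet frame of $C_\gamma$: for a regular generic curve $\gamma$, the Frenet frame $\widetilde V_1=T,\ \widetilde V_2=N_1,\ \ldots,\ \widetilde V_{m+1}=N_m$ of $C_\gamma$ at $C_\gamma(s)$ is taken to be well-defined and given by $T=\varepsilon n_m$, $N_l=\delta_l n_{m-l}$ for $1\le l\le m-1$, and $N_m=\pm t$. Here $\varepsilon(s)$ is the sign of $(c_m'+c_{m-1}\kappa_m)(s)$, $\delta_l(s)$ is the sign of $(-1)^l\varepsilon(s)\kappa_m(s)$, and the sign in $\pm t$ is chosen so that the frame is a positive basis. $k$-slant helix ($k$-type slant helix): for $1\le k\le m+1$, a curve with Frenet frame $V_1,\ldots,V_{m+1}$ is a $k$-slant helix if $V_k$ makes a constant angle $\theta_k\neq\frac{\pi}{2}$ with a fixed direction (constant unit vector) $U$ in $\mathbb{E}^{m+1}$, that is, $\langle U,V_k(s)\rangle=\cos\theta_k$ for all $s$. For $C_\gamma$ the condition is imposed on its own Frenet frame $\widetilde V_1,\ldots,\widetilde V_{m+1}$. *)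

theory Defs
  imports "HOL-Analysis.Analysis"
begin

text \<open>
  Derivatives are taken within the parameter interval \<open>S\<close>, so that they are one-sided at an
  endpoint belonging to \<open>S\<close>.
\<close>

definition nderiv :: "real set \<Rightarrow> nat \<Rightarrow> (real \<Rightarrow> 'a::real_normed_vector) \<Rightarrow> real \<Rightarrow> 'a" where
  "nderiv S j f = ((\<lambda>g s. vector_derivative g (at s within S)) ^^ j) f"

definition smooth_curve :: "real set \<Rightarrow> (real \<Rightarrow> 'a::real_normed_vector) \<Rightarrow> bool" where
  "smooth_curve S f \<longleftrightarrow> (\<forall>j. \<forall>s\<in>S. nderiv S j f differentiable (at s within S))"

definition regular_curve :: "real set \<Rightarrow> (real \<Rightarrow> 'a::real_normed_vector) \<Rightarrow> bool" where
  "regular_curve S f \<longleftrightarrow> smooth_curve S f \<and> (\<forall>s\<in>S. nderiv S 1 f s \<noteq> 0)"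

definition arclength_param :: "real set \<Rightarrow> (real \<Rightarrow> 'a::real_normed_vector) \<Rightarrow> bool" where
  "arclength_param S f \<longleftrightarrow> (\<forall>s\<in>S. norm (nderiv S 1 f s) = 1)"

text \<open>
  Below, \<open>m\<close> always stands for the number with \<open>m + 1\<close> the dimension of the ambient space.
  Injectivity makes this linear independence of the family of derivatives, not just of the
  set of its values.
\<close>

definition generic_curve :: "nat \<Rightarrow> real set \<Rightarrow> (real \<Rightarrow> 'a::euclidean_space) \<Rightarrow> bool" where
  "generic_curve m S \<gamma> \<longleftrightarrow>
     (\<forall>s\<in>S. inj_on (\<lambda>j. nderiv S j \<gamma> s) {1..m+1} \<and>
            independent ((\<lambda>j. nderiv S j \<gamma> s) ` {1..m+1}))"

text \<open>Gram--Schmidt orthonormalization of the family \<open>v 1, v 2, \<dots>\<close>; on vectors, \<open>sgn w = w / \<parallel>w\<parallel>\<close>.\<close>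

fun gram_schmidt :: "(nat \<Rightarrow> 'a::real_inner) \<Rightarrow> nat \<Rightarrow> 'a" where
  "gram_schmidt v k =
     sgn (v k - (\<Sum>i\<in>{1..<k}. (v k \<bullet> gram_schmidt v i) *\<^sub>R gram_schmidt v i))"

declare gram_schmidt.simps [simp del]

text \<open>\<open>frenet_frame S \<gamma> k\<close> is the field \<open>V\<^sub>k\<close>; hence \<open>t = V\<^sub>1\<close> and \<open>n\<^sub>i = V\<^sub>i\<^sub>+\<^sub>1\<close>, with \<open>n\<^sub>0 = t\<close>.\<close>

definition frenet_frame :: "real set \<Rightarrow> (real \<Rightarrow> 'a::euclidean_space) \<Rightarrow> nat \<Rightarrow> real \<Rightarrow> 'a" where
  "frenet_frame S \<gamma> k s = gram_schmidt (\<lambda>j. nderiv S j \<gamma> s) k"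

abbreviation frenet_normal :: "real set \<Rightarrow> (real \<Rightarrow> 'a::euclidean_space) \<Rightarrow> nat \<Rightarrow> real \<Rightarrow> 'a" where
  "frenet_normal S \<gamma> i \<equiv> frenet_frame S \<gamma> (i + 1)"

text \<open>
  \<open>\<kappa>\<^sub>i\<close> is the coefficient of \<open>n\<^sub>i\<close> in the Frenet equation for \<open>n\<^sub>i\<^sub>-\<^sub>1'\<close>
  (\<open>t' = \<kappa>\<^sub>1 n\<^sub>1\<close> if \<open>i = 1\<close>), for an arc length parameter and \<open>1 \<le> i \<le> m\<close>.
\<close>

definition frenet_curvature :: "real set \<Rightarrow> (real \<Rightarrow> 'a::euclidean_space) \<Rightarrow> nat \<Rightarrow> real \<Rightarrow> real" where
  "frenet_curvature S \<gamma> i s = nderiv S 1 (frenet_normal S \<gamma> (i - 1)) s \<bullet> frenet_normal S \<gamma> i s"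

text \<open>
  The osculating hypersphere of \<open>\<gamma>\<close> at \<open>\<gamma> s\<close> is the one having contact of order \<open>m + 1\<close>
  (\<open>m + 2\<close> coinciding points) with \<open>\<gamma>\<close> there: the equation of the sphere, evaluated along
  the curve, vanishes at \<open>s\<close> together with its first \<open>m + 1\<close> derivatives.
\<close>

definition osculating_sphere ::
    "nat \<Rightarrow> real set \<Rightarrow> (real \<Rightarrow> 'a::euclidean_space) \<Rightarrow> real \<Rightarrow> 'a \<Rightarrow> real \<Rightarrow> bool" where
  "osculating_sphere m S \<gamma> s c r \<longleftrightarrow>
     r > 0 \<and> (\<forall>j\<le>m+1. nderiv S j (\<lambda>u. (dist (\<gamma> u) c)\<^sup>2 - r\<^sup>2) s = 0)"

definition focal_curve :: "nat \<Rightarrow> real set \<Rightarrow> (real \<Rightarrow> 'a::euclidean_space) \<Rightarrow> real \<Rightarrow> 'a" where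
  "focal_curve m S \<gamma> s = (THE c. \<exists>r. osculating_sphere m S \<gamma> s c r)"

text \<open>
  The coefficient of \<open>n\<^sub>i\<close> in \<open>C\<^sub>\<gamma> = \<gamma> + c\<^sub>1 n\<^sub>1 + \<dots> + c\<^sub>m n\<^sub>m\<close>. For \<open>i = 0\<close> it is the
  tangential coefficient of \<open>C\<^sub>\<gamma> - \<gamma>\<close>, so \<open>c\<^sub>0 = 0\<close>, which is the right convention
  for \<open>c\<^sub>m\<^sub>-\<^sub>1\<close> when \<open>m = 1\<close>.
\<close>

definition focal_curvature :: "nat \<Rightarrow> real set \<Rightarrow> (real \<Rightarrow> 'a::euclidean_space) \<Rightarrow> nat \<Rightarrow> real \<Rightarrow> real" where
  "focal_curvature m S \<gamma> i s = (focal_curve m S \<gamma> s - \<gamma> s) \<bullet> frenet_normal S \<gamma> i s"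

definition focal_eps :: "nat \<Rightarrow> real set \<Rightarrow> (real \<Rightarrow> 'a::euclidean_space) \<Rightarrow> real \<Rightarrow> real" where
  "focal_eps m S \<gamma> s =
     sgn (nderiv S 1 (focal_curvature m S \<gamma> m) s
          + focal_curvature m S \<gamma> (m - 1) s * frenet_curvature S \<gamma> m s)"

definition focal_delta :: "nat \<Rightarrow> real set \<Rightarrow> (real \<Rightarrow> 'a::euclidean_space) \<Rightarrow> nat \<Rightarrow> real \<Rightarrow> real" where
  "focal_delta m S \<gamma> l s = sgn ((-1) ^ l * focal_eps m S \<gamma> s * frenet_curvature S \<gamma> m s)"

text \<open>
  Orientation of \<open>real ^ 'n\<close> with the coordinates taken in the order of \<open>'n\<close>: the row of the
  matrix belonging to the \<open>k\<close>-th smallest index is \<open>B k\<close>, for \<open>1 \<le> k \<le> CARD('n)\<close>.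
\<close>

definition positive_basis :: "(nat \<Rightarrow> real ^ 'n::{finite,linorder}) \<Rightarrow> bool" where
  "positive_basis B \<longleftrightarrow> det (\<chi> i. B (card {j. j \<le> i})) > 0"

text \<open>
  The frame \<open>T, N\<^sub>1, \<dots>, N\<^sub>m\<close> of the focal curve, numbered from 1 so that
  \<open>N\<^sub>l\<close> has number \<open>l + 1\<close>; \<open>\<sigma>\<close> is the sign in \<open>N\<^sub>m = \<plusminus>t\<close>.
\<close>

definition focal_frame_with_sign ::
    "real \<Rightarrow> nat \<Rightarrow> real set \<Rightarrow> (real \<Rightarrow> 'a::euclidean_space) \<Rightarrow> nat \<Rightarrow> real \<Rightarrow> 'a" where
  "focal_frame_with_sign \<sigma> m S \<gamma> k s =
     (if k = 1 then focal_eps m S \<gamma> s *\<^sub>R frenet_normal S \<gamma> m s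
      else if k \<le> m then focal_delta m S \<gamma> (k - 1) s *\<^sub>R frenet_normal S \<gamma> (m - (k - 1)) s
      else \<sigma> *\<^sub>R frenet_frame S \<gamma> 1 s)"

definition focal_frame ::
    "nat \<Rightarrow> real set \<Rightarrow> (real \<Rightarrow> real ^ 'n::{finite,linorder}) \<Rightarrow> nat \<Rightarrow> real \<Rightarrow> real ^ 'n::{finite,linorder}" where
  "focal_frame m S \<gamma> k s =
     (if positive_basis (\<lambda>i. focal_frame_with_sign 1 m S \<gamma> i s)
      then focal_frame_with_sign 1 m S \<gamma> k s
      else focal_frame_with_sign (-1) m S \<gamma> k s)"

text \<open>
  Since \<open>C\<^sub>\<gamma>' = (c\<^sub>m' + c\<^sub>m\<^sub>-\<^sub>1 \<kappa>\<^sub>m) n\<^sub>m\<close>, the focal curve is regular, and the vectors above form an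
  orthonormal frame, exactly where \<open>\<epsilon> \<noteq> 0\<close>; elsewhere \<open>T = \<epsilon> n\<^sub>m\<close> would be the zero vector.
\<close>

definition focal_frame_well_defined :: "nat \<Rightarrow> real set \<Rightarrow> (real \<Rightarrow> 'a::euclidean_space) \<Rightarrow> bool" where
  "focal_frame_well_defined m S \<gamma> \<longleftrightarrow> (\<forall>s\<in>S. focal_eps m S \<gamma> s \<noteq> 0)"

text \<open>Angles between vectors lie in \<open>[0, \<pi>]\<close>, so \<open>\<theta> \<noteq> \<pi>/2\<close> excludes \<open>cos \<theta> = 0\<close>.\<close>

definition slant_helix :: "real set \<Rightarrow> (nat \<Rightarrow> real \<Rightarrow> 'a::euclidean_space) \<Rightarrow> nat \<Rightarrow> bool" where
  "slant_helix S V k \<longleftrightarrow>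
     (\<exists>U \<theta>. norm U = 1 \<and> 0 \<le> \<theta> \<and> \<theta> \<le> pi \<and> \<theta> \<noteq> pi / 2 \<and> (\<forall>s\<in>S. U \<bullet> V k s = cos \<theta>))"

end

theory Submission
  imports Defs
begin

text \<open>
  Up to signs, the \<open>k\<close>-th frame vector of the focal curve is \<open>V\<^sub>m\<^sub>+\<^sub>2\<^sub>-\<^sub>k\<close>, so the theorem amounts to
  these signs being constant on the interval \<open>S\<close>. The centre \<open>c\<close> of the osculating sphere solves
  the linear system \<open>2 \<gamma>\<^sup>(\<^sup>j\<^sup>) \<bullet> c = (\<gamma> \<bullet> \<gamma>)\<^sup>(\<^sup>j\<^sup>)\<close>, \<open>1 \<le> j \<le> m + 1\<close>, hence depends smoothly on the
  parameter, and \<open>c\<^sub>m' + c\<^sub>m\<^sub>-\<^sub>1 \<kappa>\<^sub>m\<close> is continuous; it has no zero, so \<open>\<epsilon>\<close> is constant. As \<open>\<kappa>\<^sub>m > 0\<close>,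
  every \<open>\<delta>\<^sub>l\<close> is constant as well, and then so is the sign of \<open>t\<close>, because the determinant of the
  frame is continuous without zeros.
\<close>

section \<open>Finite differentiability relative to a set\<close>

text \<open>
  The derivative is existentially quantified, so that closure properties hold without
  uniqueness of derivatives within \<open>S\<close>.
\<close>

fun Ck_on :: "nat \<Rightarrow> real set \<Rightarrow> (real \<Rightarrow> 'a::real_normed_vector) \<Rightarrow> bool" where
  "Ck_on 0 S f \<longleftrightarrow> continuous_on S f"
| "Ck_on (Suc n) S f \<longleftrightarrow>
     (\<exists>f'. (\<forall>s\<in>S. (f has_vector_derivative f' s) (at s within S)) \<and> Ck_on n S f')"

lemma Ck_on_SucI:
  assumes "\<And>s. s \<in> S \<Longrightarrow> (f has_vector_derivative f' s) (at s within S)" and "Ck_on n S f'"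
  shows "Ck_on (Suc n) S f"
  using assms by auto

lemma Ck_on_SucE:
  assumes "Ck_on (Suc n) S f"
  obtains f' where "\<And>s. s \<in> S \<Longrightarrow> (f has_vector_derivative f' s) (at s within S)" "Ck_on n S f'"
  using assms by auto

lemma Ck_on_cong:
  assumes "Ck_on n S f" and "\<And>s. s \<in> S \<Longrightarrow> f s = g s"
  shows "Ck_on n S g"
proof (cases n)
  case 0
  with assms show ?thesis
    using continuous_on_cong by force
next
  case (Suc k)
  with assms(1) obtain f' where
    f': "\<And>s. s \<in> S \<Longrightarrow> (f has_vector_derivative f' s) (at s within S)" "Ck_on k S f'"
    by (auto elim: Ck_on_SucE)
  have "(g has_vector_derivative f' s) (at s within S)" if "s \<in> S" for s
    using has_vector_derivative_transform[OF that _ f'(1)[OF that]] assms(2) by simp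
  with f'(2) Suc show ?thesis
    by (auto intro: Ck_on_SucI)
qed

lemma Ck_on_Suc_imp_continuous_on: "Ck_on (Suc n) S f \<Longrightarrow> continuous_on S f"
  by (auto elim!: Ck_on_SucE intro: has_vector_derivative_continuous
           simp: continuous_on_eq_continuous_within)

lemma Ck_on_SucD: "Ck_on (Suc n) S f \<Longrightarrow> Ck_on n S f"
proof (induction n arbitrary: f)
  case 0
  then have "continuous_on S f" by (rule Ck_on_Suc_imp_continuous_on)
  then show ?case by simp
next
  case (Suc n)
  from Suc.prems obtain f' where
    "\<And>s. s \<in> S \<Longrightarrow> (f has_vector_derivative f' s) (at s within S)" "Ck_on (Suc n) S f'"
    by (rule Ck_on_SucE) blast
  then show ?case
    using Suc.IH by (intro Ck_on_SucI)
qed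

lemma Ck_on_const: "Ck_on n S (\<lambda>s. c)"
proof (induction n arbitrary: c)
  case (Suc n)
  show ?case
    by (rule Ck_on_SucI[OF _ Suc]) (rule has_vector_derivative_const)
qed simp

lemma Ck_on_add:
  assumes "Ck_on n S f" and "Ck_on n S g"
  shows "Ck_on n S (\<lambda>s. f s + g s)"
  using assms
proof (induction n arbitrary: f g)
  case 0
  then show ?case by (simp add: continuous_on_add)
next
  case (Suc n)
  from Suc.prems obtain f' g' where
    "\<And>s. s \<in> S \<Longrightarrow> (f has_vector_derivative f' s) (at s within S)" "Ck_on n S f'"
    "\<And>s. s \<in> S \<Longrightarrow> (g has_vector_derivative g' s) (at s within S)" "Ck_on n S g'"
    by (metis Ck_on_SucE)
  then show ?case
    by (intro Ck_on_SucI[where f' = "\<lambda>s. f' s + g' s"])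
      (auto intro: has_vector_derivative_add Suc.IH)
qed

text \<open>Induction through the product rule: each summand keeps one factor undifferentiated, and
  \<open>Ck_on_SucD\<close> lowers the order of that factor. Inner product, scaling and
  multiplication are all instances.\<close>

lemma (in bounded_bilinear) Ck_on:
  assumes "Ck_on n S f" and "Ck_on n S g"
  shows "Ck_on n S (\<lambda>s. prod (f s) (g s))"
  using assms
proof (induction n arbitrary: f g)
  case 0
  then show ?case by (simp add: continuous_on)
next
  case (Suc n)
  from Suc.prems obtain f' g' where
    "\<And>s. s \<in> S \<Longrightarrow> (f has_vector_derivative f' s) (at s within S)" "Ck_on n S f'"
    "\<And>s. s \<in> S \<Longrightarrow> (g has_vector_derivative g' s) (at s within S)" "Ck_on n S g'"
    by (metis Ck_on_SucE)
  moreover have "Ck_on n S f" "Ck_on n S g"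
    using Suc.prems Ck_on_SucD by blast+
  ultimately show ?case
    by (intro Ck_on_SucI[where f' = "\<lambda>s. prod (f s) (g' s) + prod (f' s) (g s)"])
      (auto intro: has_vector_derivative Suc.IH Ck_on_add)
qed

lemmas Ck_on_inner = bounded_bilinear.Ck_on[OF bounded_bilinear_inner]
lemmas Ck_on_scaleR = bounded_bilinear.Ck_on[OF bounded_bilinear_scaleR]
lemmas Ck_on_mult = bounded_bilinear.Ck_on[OF bounded_bilinear_mult]

lemma Ck_on_diff:
  assumes "Ck_on n S f" and "Ck_on n S g"
  shows "Ck_on n S (\<lambda>s. f s - g s)"
  using Ck_on_add[OF assms(1) Ck_on_scaleR[OF Ck_on_const[where c = "-1"] assms(2)]] by simp

lemma Ck_on_sum:
  assumes "\<And>i. i \<in> A \<Longrightarrow> Ck_on n S (f i)"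
  shows "Ck_on n S (\<lambda>s. \<Sum>i\<in>A. f i s)"
  using assms by (induction A rule: infinite_finite_induct) (auto intro: Ck_on_const Ck_on_add)

lemma Ck_on_inverse:
  fixes f :: "real \<Rightarrow> real"
  assumes "Ck_on n S f" and "\<And>s. s \<in> S \<Longrightarrow> f s \<noteq> 0"
  shows "Ck_on n S (\<lambda>s. inverse (f s))"
  using assms
proof (induction n)
  case 0
  then show ?case by (auto intro: continuous_on_inverse)
next
  case (Suc n)
  from Suc.prems(1) obtain f' where
    f': "\<And>s. s \<in> S \<Longrightarrow> (f has_vector_derivative f' s) (at s within S)" "Ck_on n S f'"
    by (rule Ck_on_SucE) blast
  have IH: "Ck_on n S (\<lambda>s. inverse (f s))"
    using Suc Ck_on_SucD by blast
  show ?case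
  \<comment> \<open>The derivative contains \<open>inverse (f s)\<close> again, but only to order
    \<open>n\<close>, so the induction hypothesis applies. The factor \<open>- 1\<close> makes it a
    pure product, within reach of \<open>Ck_on_mult\<close>.\<close>
  proof (rule Ck_on_SucI[where f' = "\<lambda>s. - 1 * (inverse (f s) * f' s * inverse (f s))"])
    fix s assume "s \<in> S"
    then show "((\<lambda>s. inverse (f s)) has_vector_derivative
        - 1 * (inverse (f s) * f' s * inverse (f s))) (at s within S)"
      using DERIV_inverse'[of f "f' s" s S] f'(1) Suc.prems(2)
      by (simp add: has_real_derivative_iff_has_vector_derivative)
  qed (intro Ck_on_mult IH f'(2) Ck_on_const)
qed

lemma Ck_on_sqrt:
  assumes "Ck_on n S f" and "\<And>s. s \<in> S \<Longrightarrow> f s > 0"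
  shows "Ck_on n S (\<lambda>s. sqrt (f s))"
  using assms
proof (induction n)
  case 0
  then show ?case by (auto intro: continuous_on_real_sqrt)
next
  case (Suc n)
  from Suc.prems(1) obtain f' where
    f': "\<And>s. s \<in> S \<Longrightarrow> (f has_vector_derivative f' s) (at s within S)" "Ck_on n S f'"
    by (rule Ck_on_SucE) blast
  have IH: "Ck_on n S (\<lambda>s. sqrt (f s))"
    using Suc Ck_on_SucD by blast
  show ?case
  proof (rule Ck_on_SucI[where f' = "\<lambda>s. inverse (sqrt (f s)) * (1/2) * f' s"])
    fix s assume s: "s \<in> S"
    have "(sqrt has_real_derivative inverse (sqrt (f s)) / 2) (at (f s))"
      using Suc.prems(2)[OF s] by (rule DERIV_real_sqrt)
    then have "((\<lambda>s. sqrt (f s)) has_real_derivative inverse (sqrt (f s)) / 2 * f' s) (at s within S)"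
      using f'(1)[OF s]
      by (intro DERIV_chain2[of sqrt]) (auto simp: has_real_derivative_iff_has_vector_derivative)
    then show "((\<lambda>s. sqrt (f s)) has_vector_derivative inverse (sqrt (f s)) * (1/2) * f' s) (at s within S)"
      by (simp add: has_real_derivative_iff_has_vector_derivative)
  next
    show "Ck_on n S (\<lambda>s. inverse (sqrt (f s)) * (1/2) * f' s)"
      using Suc.prems(2) by (intro Ck_on_mult Ck_on_inverse IH f'(2) Ck_on_const) force
  qed
qed

lemma Ck_on_sgn:
  fixes f :: "real \<Rightarrow> 'a::real_inner"
  assumes "Ck_on n S f" and "\<And>s. s \<in> S \<Longrightarrow> f s \<noteq> 0"
  shows "Ck_on n S (\<lambda>s. sgn (f s))"
proof -
  have "Ck_on n S (\<lambda>s. inverse (sqrt (f s \<bullet> f s)) *\<^sub>R f s)"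
    using assms by (intro Ck_on_scaleR Ck_on_inverse Ck_on_sqrt Ck_on_inner) auto
  then show ?thesis
    by (simp add: sgn_div_norm norm_eq_sqrt_inner)
qed

section \<open>Iterated derivatives\<close>

lemma nderiv_0 [simp]: "nderiv S 0 f = f"
  by (simp add: nderiv_def)

lemma nderiv_Suc: "nderiv S (Suc j) f s = vector_derivative (nderiv S j f) (at s within S)"
  by (simp add: nderiv_def)

text \<open>A connected set with more than one point has no isolated points. This makes derivatives
  within \<open>S\<close> unique, including those at endpoints.\<close>

lemma at_within_interval_neq_bot:
  assumes "is_interval S" and "interior S \<noteq> {}" and "s \<in> S"
  shows "at s within S \<noteq> (bot :: real filter)"
proof -
  have "infinite S"
    using assms(2) interior_subset
    by (metis finite_imp_closed finite_imp_not_open finite_subset open_interior)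
  then have "\<nexists>a. S = {a}"
    by auto
  then have "s islimpt S"
    using assms(1,3) connected_imp_perfect is_interval_connected by blast
  then show ?thesis
    by (simp add: trivial_limit_within)
qed

context
  fixes S :: "real set"
  assumes perfect: "\<And>s. s \<in> S \<Longrightarrow> at s within S \<noteq> bot"
begin

lemma Ck_on_nderiv_1:
  assumes "Ck_on (Suc n) S f"
  shows "Ck_on n S (nderiv S 1 f)"
proof -
  obtain f' where f': "\<And>s. s \<in> S \<Longrightarrow> (f has_vector_derivative f' s) (at s within S)" "Ck_on n S f'"
    using assms by (rule Ck_on_SucE) blast
  have "f' s = nderiv S 1 f s" if "s \<in> S" for s
    using vector_derivative_within[OF perfect[OF that] f'(1)[OF that]] by (simp add: nderiv_Suc)
  with f'(2) show ?thesis
    by (rule Ck_on_cong)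
qed

text \<open>Allows iterated derivatives to be computed by induction from formulas that hold only on
  \<open>S\<close>.\<close>

lemma nderiv_Suc_eqI:
  assumes "s \<in> S" and "\<And>u. u \<in> S \<Longrightarrow> nderiv S j f u = g u"
    and "(g has_vector_derivative d) (at s within S)"
  shows "nderiv S (Suc j) f s = d"
proof -
  have "(nderiv S j f has_vector_derivative d) (at s within S)"
    using has_vector_derivative_transform[OF assms(1) _ assms(3)] assms(2) by simp
  then show ?thesis
    using vector_derivative_within[OF perfect[OF assms(1)]] by (simp add: nderiv_Suc)
qed

text \<open>Carries the closure properties of \<open>Ck_on\<close> over to smoothness. Forward, the
  \<open>nderiv\<close> are the witnesses; backward, uniqueness identifies any witness with
  \<open>nderiv\<close>.\<close>

lemma smooth_curve_iff_Ck_on: "smooth_curve S f \<longleftrightarrow> (\<forall>n. Ck_on n S f)"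
proof
  assume f: "smooth_curve S f"
  have D: "(nderiv S j f has_vector_derivative nderiv S (Suc j) f s) (at s within S)"
    if "s \<in> S" for j s
    using f that unfolding smooth_curve_def nderiv_Suc
    using vector_derivative_works by blast
  \<comment> \<open>Stated for all \<open>j\<close>, since raising \<open>n\<close> by one passes to
    the next derivative.\<close>
  have "Ck_on n S (nderiv S j f)" for n j
  proof (induction n arbitrary: j)
    case 0
    then show ?case
      using D has_vector_derivative_continuous continuous_on_eq_continuous_within by force
  next
    case (Suc n)
    show ?case by (rule Ck_on_SucI[OF D Suc])
  qed
  from this[of _ 0] show "\<forall>n. Ck_on n S f" by simp
next
  assume f: "\<forall>n. Ck_on n S f"
  have *: "Ck_on n S (nderiv S j f)" for n j
  proof (induction j arbitrary: n)
    case 0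
    then show ?case using f by simp
  next
    case (Suc j)
    show ?case
      by (rule Ck_on_cong[OF Ck_on_nderiv_1[OF Suc]]) (simp add: nderiv_Suc)
  qed
  show "smooth_curve S f"
    unfolding smooth_curve_def
  proof (intro allI ballI)
    fix j s assume s: "s \<in> S"
    obtain g where "(nderiv S j f has_vector_derivative g s) (at s within S)"
      using *[of "Suc 0" j] s by auto
    then show "nderiv S j f differentiable (at s within S)"
      by (rule differentiableI_vector)
  qed
qed

lemma has_vector_derivative_nderiv:
  assumes "smooth_curve S f" and "s \<in> S"
  shows "(nderiv S j f has_vector_derivative nderiv S (Suc j) f s) (at s within S)"
  using assms unfolding smooth_curve_def nderiv_Suc
  using vector_derivative_works by blast

lemma smooth_curve_nderiv:
  assumes "smooth_curve S f"
  shows "smooth_curve S (nderiv S j f)"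
  using assms unfolding smooth_curve_def nderiv_def by (metis comp_apply funpow_add)

end

section \<open>Gram--Schmidt orthonormalization\<close>

text \<open>The vector before normalization. Its norm is the diagonal entry in the triangular
  relation between \<open>v\<close> and its orthonormalization.\<close>

definition gram_schmidt_residual :: "(nat \<Rightarrow> 'a::real_inner) \<Rightarrow> nat \<Rightarrow> 'a" where
  "gram_schmidt_residual v k = v k - (\<Sum>i\<in>{1..<k}. (v k \<bullet> gram_schmidt v i) *\<^sub>R gram_schmidt v i)"

lemma gram_schmidt_eq_sgn: "gram_schmidt v k = sgn (gram_schmidt_residual v k)"
  by (simp add: gram_schmidt_residual_def gram_schmidt.simps[of v k])

lemma gram_schmidt_in_span: "1 \<le> k \<Longrightarrow> gram_schmidt v k \<in> span (v ` {1..k})"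
proof (induction k rule: less_induct)
  case (less k)
  have "gram_schmidt v i \<in> span (v ` {1..k})" if "i \<in> {1..<k}" for i
    using less.IH[of i] that span_mono[of "v ` {1..i}" "v ` {1..k}"] by fastforce
  moreover have "v k \<in> span (v ` {1..k})"
    using less.prems by (intro span_base) auto
  ultimately show ?case
    unfolding gram_schmidt_eq_sgn[of v k] gram_schmidt_residual_def sgn_div_norm
    by (intro span_scale span_diff span_sum) auto
qed

text \<open>The Gram-Schmidt step solved for \<open>v k\<close>. It survives a vanishing residual
  because \<open>sgn 0 = 0\<close>.\<close>

lemma gram_schmidt_decomp:
  "v k = norm (gram_schmidt_residual v k) *\<^sub>R gram_schmidt v k
       + (\<Sum>i\<in>{1..<k}. (v k \<bullet> gram_schmidt v i) *\<^sub>R gram_schmidt v i)"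
proof -
  have "norm (gram_schmidt_residual v k) *\<^sub>R gram_schmidt v k = gram_schmidt_residual v k"
    by (cases "gram_schmidt_residual v k = 0") (simp_all add: gram_schmidt_eq_sgn sgn_div_norm)
  then show ?thesis by (simp add: gram_schmidt_residual_def)
qed

lemma inner_gram_schmidt_eq_0:
  assumes "1 \<le> k" and "\<And>i. 1 \<le> i \<Longrightarrow> i \<le> k \<Longrightarrow> z \<bullet> v i = 0"
  shows "z \<bullet> gram_schmidt v k = 0"
proof -
  have "orthogonal z (gram_schmidt v k)"
    by (rule orthogonal_to_span[OF gram_schmidt_in_span[OF assms(1)]])
      (auto simp: orthogonal_def assms(2))
  then show ?thesis by (simp add: orthogonal_def)
qed

context
  fixes v :: "nat \<Rightarrow> 'a::real_inner" and N :: nat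
  assumes inj: "inj_on v {1..N}" and indep: "independent (v ` {1..N})"
begin

lemma gram_schmidt_residual_neq_0:
  assumes "k \<in> {1..N}"
  shows "gram_schmidt_residual v k \<noteq> 0"
proof
  assume "gram_schmidt_residual v k = 0"
  then have "v k = (\<Sum>i\<in>{1..<k}. (v k \<bullet> gram_schmidt v i) *\<^sub>R gram_schmidt v i)"
    by (simp add: gram_schmidt_residual_def)
  also have "\<dots> \<in> span (v ` {1..<k})"
  proof (intro span_sum span_scale)
    fix i assume "i \<in> {1..<k}"
    then show "gram_schmidt v i \<in> span (v ` {1..<k})"
      using gram_schmidt_in_span[of i v] span_mono[of "v ` {1..i}" "v ` {1..<k}"] by fastforce
  qed
  \<comment> \<open>Injectivity keeps the earlier vectors different from \<open>v k\<close>, so they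
    remain after its removal.\<close>
  also have "\<dots> \<subseteq> span (v ` {1..N} - {v k})"
    using assms inj by (intro span_mono) (fastforce dest: inj_onD)
  finally have "dependent (v ` {1..N})"
    using assms unfolding dependent_def by blast
  with indep show False by simp
qed

lemma inner_gram_schmidt_self: "k \<in> {1..N} \<Longrightarrow> gram_schmidt v k \<bullet> gram_schmidt v k = 1"
  using gram_schmidt_residual_neq_0[of k]
  by (simp add: gram_schmidt_eq_sgn[of v k] norm_sgn flip: norm_eq_1)

text \<open>Strong induction: by orthonormality of the earlier vectors, the subtracted sum has the
  same inner product with \<open>gram_schmidt v i\<close> as \<open>v k\<close>.\<close>

lemma inner_gram_schmidt_less:
  assumes "i \<in> {1..<k}" and "k \<le> N"
  shows "gram_schmidt v k \<bullet> gram_schmidt v i = 0"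
  using assms
proof (induction k arbitrary: i rule: less_induct)
  case (less k)
  have orth: "gram_schmidt v j \<bullet> gram_schmidt v i = (if j = i then 1 else 0)" if "j \<in> {1..<k}" for j
  proof (cases j i rule: linorder_cases)
    case less': less
    then show ?thesis
      using less.IH[of i j] less.prems that by (auto simp: inner_commute)
  next
    case equal
    then show ?thesis
      using inner_gram_schmidt_self[of i] less.prems by auto
  next
    case greater
    then show ?thesis
      using less.IH[of j i] less.prems that by auto
  qed
  have "(\<Sum>j\<in>{1..<k}. (v k \<bullet> gram_schmidt v j) * (gram_schmidt v j \<bullet> gram_schmidt v i))
      = (\<Sum>j\<in>{1..<k}. if j = i then v k \<bullet> gram_schmidt v j else 0)"
    using orth by (intro sum.cong) auto
  also have "\<dots> = v k \<bullet> gram_schmidt v i"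
    using less.prems by (simp add: sum.delta)
  finally show ?case
    by (simp add: gram_schmidt_eq_sgn[of v k] sgn_div_norm gram_schmidt_residual_def
        inner_diff_left inner_sum_left)
qed

lemma inner_gram_schmidt:
  assumes "i \<in> {1..N}" and "k \<in> {1..N}"
  shows "gram_schmidt v i \<bullet> gram_schmidt v k = (if i = k then 1 else 0)"
  using assms inner_gram_schmidt_self[of i] inner_gram_schmidt_less[of i k] inner_gram_schmidt_less[of k i]
  by (cases i k rule: linorder_cases) (auto simp: inner_commute)

text \<open>Triangularity, as in a QR factorization: \<open>v i\<close> involves only the first
  \<open>i\<close> orthonormal vectors.\<close>

lemma inner_vector_gram_schmidt:
  assumes "1 \<le> i" and "i \<le> k" and "k \<le> N"
  shows "v i \<bullet> gram_schmidt v k = (if i = k then norm (gram_schmidt_residual v k) else 0)"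
proof -
  have "(\<Sum>j\<in>{1..<i}. (v i \<bullet> gram_schmidt v j) * (gram_schmidt v j \<bullet> gram_schmidt v k)) = 0"
    using assms by (intro sum.neutral) (auto simp: inner_gram_schmidt)
  moreover have "gram_schmidt v i \<bullet> gram_schmidt v k = (if i = k then 1 else 0)"
    using assms by (intro inner_gram_schmidt) auto
  ultimately show ?thesis
    by (subst gram_schmidt_decomp) (simp add: inner_add_left inner_sum_left)
qed

end

text \<open>The family spans the space, so \<open>x\<close> is orthogonal to itself. This gives
  uniqueness of the osculating centre.\<close>

lemma orthogonal_independent_family_eq_0:
  fixes v :: "nat \<Rightarrow> 'a::euclidean_space"
  assumes "inj_on v {1..DIM('a)}" and "independent (v ` {1..DIM('a)})"
    and "\<And>j. j \<in> {1..DIM('a)} \<Longrightarrow> v j \<bullet> x = 0"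
  shows "x = 0"
proof -
  have "card (v ` {1..DIM('a)}) = DIM('a)"
    using assms(1) by (simp add: card_image)
  then have "span (v ` {1..DIM('a)}) = UNIV"
    using assms(2) by (metis dim_eq_card_independent dim_eq_full)
  moreover have "orthogonal x x" if "x \<in> span (v ` {1..DIM('a)})"
    by (rule orthogonal_to_span[OF that]) (use assms(3) in \<open>auto simp: orthogonal_def inner_commute\<close>)
  ultimately show ?thesis
    by (simp add: orthogonal_def)
qed

text \<open>Follows the recursion; normalization preserves differentiability because independence
  keeps the residuals away from zero.\<close>

lemma Ck_on_gram_schmidt:
  fixes v :: "nat \<Rightarrow> real \<Rightarrow> 'a::real_inner"
  assumes "\<And>j. j \<in> {1..N} \<Longrightarrow> Ck_on n S (v j)"
    and "\<And>s. s \<in> S \<Longrightarrow> inj_on (\<lambda>j. v j s) {1..N} \<and> independent ((\<lambda>j. v j s) ` {1..N})"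
    and "k \<in> {1..N}"
  shows "Ck_on n S (\<lambda>s. gram_schmidt (\<lambda>j. v j s) k)"
  using assms(3)
proof (induction k rule: less_induct)
  case (less k)
  have "Ck_on n S (\<lambda>s. gram_schmidt_residual (\<lambda>j. v j s) k)"
    unfolding gram_schmidt_residual_def
    using less assms(1) by (intro Ck_on_diff Ck_on_sum Ck_on_scaleR Ck_on_inner) auto
  then show ?case
    unfolding gram_schmidt_eq_sgn[of _ k]
    using assms(2) less.prems gram_schmidt_residual_neq_0 by (intro Ck_on_sgn) blast+
qed

text \<open>
  The Gram--Schmidt vectors make the system \<open>v j \<bullet> c = b j\<close> triangular, so that it can be solved
  by adding one vector at a time, with coefficients that stay smooth.
\<close>

lemma linear_system_smooth_solution:
  fixes v :: "nat \<Rightarrow> real \<Rightarrow> 'a::real_inner"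
  assumes v: "\<And>n j. j \<in> {1..N} \<Longrightarrow> Ck_on n S (v j)"
    and indep: "\<And>s. s \<in> S \<Longrightarrow> inj_on (\<lambda>j. v j s) {1..N} \<and> independent ((\<lambda>j. v j s) ` {1..N})"
    and b: "\<And>n j. j \<in> {1..N} \<Longrightarrow> Ck_on n S (b j)"
  obtains c where "\<And>n. Ck_on n S c" "\<And>s j. s \<in> S \<Longrightarrow> j \<in> {1..N} \<Longrightarrow> v j s \<bullet> c s = b j s"
proof -
  have "\<exists>c. (\<forall>n. Ck_on n S c) \<and> (\<forall>s\<in>S. \<forall>j\<in>{1..M}. v j s \<bullet> c s = b j s)" if "M \<le> N" for M
    using that
  proof (induction M)
    case 0
    then show ?case
      using Ck_on_const[where c = 0] by force
  next
    case (Suc M)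
    then obtain c where c: "\<And>n. Ck_on n S c" "\<And>s j. s \<in> S \<Longrightarrow> j \<in> {1..M} \<Longrightarrow> v j s \<bullet> c s = b j s"
      using Suc_leD by blast
    let ?e = "\<lambda>s. gram_schmidt (\<lambda>j. v j s) (Suc M)"
    \<comment> \<open>The coefficient is the defect of \<open>c\<close> in the new equation divided
      by the diagonal entry. Since \<open>?e\<close> is orthogonal to the earlier
      \<open>v j\<close>, the equations already solved are undisturbed.\<close>
    let ?c = "\<lambda>s. c s + ((b (Suc M) s - v (Suc M) s \<bullet> c s) * inverse (v (Suc M) s \<bullet> ?e s)) *\<^sub>R ?e s"
    have e0: "v j s \<bullet> ?e s = 0" if "s \<in> S" "j \<in> {1..M}" for s j
      using inner_vector_gram_schmidt[of "\<lambda>j. v j s" N j "Suc M"] indep that Suc.prems by auto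
    have e1: "v (Suc M) s \<bullet> ?e s \<noteq> 0" if "s \<in> S" for s
      using inner_vector_gram_schmidt[of "\<lambda>j. v j s" N "Suc M" "Suc M"]
        gram_schmidt_residual_neq_0[of "\<lambda>j. v j s" N "Suc M"] indep that Suc.prems by auto
    have "Ck_on n S ?c" for n
      using Suc.prems v indep b c(1) e1
      by (intro Ck_on_add Ck_on_scaleR Ck_on_mult Ck_on_diff Ck_on_inner Ck_on_inverse
          Ck_on_gram_schmidt[where N = N]) auto
    moreover have "v j s \<bullet> ?c s = b j s" if "s \<in> S" "j \<in> {1..Suc M}" for s j
      using that e0[of s j] e1[of s] c(2)[of s j]
      by (cases "j = Suc M") (auto simp: inner_add_right mult.assoc)
    ultimately show ?case by blast
  qed
  from this[of N] that show ?thesis by blast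
qed

section \<open>The focal curve and its frame\<close>

context
  fixes S :: "real set" and \<gamma> :: "real \<Rightarrow> 'a::euclidean_space" and m :: nat
  assumes perfect: "\<And>s. s \<in> S \<Longrightarrow> at s within S \<noteq> bot"
    and dim: "DIM('a) = m + 1" and m: "m \<ge> 1"
    and smooth: "smooth_curve S \<gamma>" and generic: "generic_curve m S \<gamma>"
begin

lemma generic_indep:
  assumes "s \<in> S"
  shows "inj_on (\<lambda>j. nderiv S j \<gamma> s) {1..m+1}" "independent ((\<lambda>j. nderiv S j \<gamma> s) ` {1..m+1})"
  using generic assms unfolding generic_curve_def by auto

lemma Ck_on_nderiv_curve: "Ck_on n S (nderiv S j \<gamma>)"
  using smooth_curve_nderiv[OF perfect smooth] smooth_curve_iff_Ck_on[OF perfect] by blast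

lemma Ck_on_frenet_frame: "k \<in> {1..m+1} \<Longrightarrow> Ck_on n S (frenet_frame S \<gamma> k)"
  using Ck_on_gram_schmidt[where N = "m + 1" and v = "\<lambda>j. nderiv S j \<gamma>"]
    Ck_on_nderiv_curve generic_indep
  unfolding frenet_frame_def[abs_def] by blast

lemma inner_frenet_frame:
  assumes "s \<in> S" and "i \<in> {1..m+1}" and "k \<in> {1..m+1}"
  shows "frenet_frame S \<gamma> i s \<bullet> frenet_frame S \<gamma> k s = (if i = k then 1 else 0)"
  unfolding frenet_frame_def using inner_gram_schmidt[OF generic_indep] assms by blast

lemma smooth_curve_inner_self: "smooth_curve S (\<lambda>u. \<gamma> u \<bullet> \<gamma> u)"
  using smooth Ck_on_inner[of _ S \<gamma> \<gamma>] by (simp add: smooth_curve_iff_Ck_on[OF perfect])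

text \<open>Expanding the squared distance makes the contact conditions of order at least 1 linear
  in \<open>c\<close>: the quadratic term \<open>c \<bullet> c\<close> is constant along the
  curve.\<close>

lemma nderiv_sphere_equation:
  assumes "s \<in> S"
  shows "nderiv S j (\<lambda>u. (dist (\<gamma> u) c)\<^sup>2 - r\<^sup>2) s
       = nderiv S j (\<lambda>u. \<gamma> u \<bullet> \<gamma> u) s - 2 * (nderiv S j \<gamma> s \<bullet> c) + (if j = 0 then c \<bullet> c - r\<^sup>2 else 0)"
  using assms
proof (induction j arbitrary: s)
  case 0
  then show ?case
    by (simp add: dist_norm power2_norm_eq_inner inner_diff_left inner_diff_right inner_commute)
next
  case (Suc j)
  let ?k = "if j = 0 then c \<bullet> c - r\<^sup>2 else 0"
  have "((\<lambda>u. nderiv S j (\<lambda>u. \<gamma> u \<bullet> \<gamma> u) u - 2 * (nderiv S j \<gamma> u \<bullet> c) + ?k)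
      has_vector_derivative
        nderiv S (Suc j) (\<lambda>u. \<gamma> u \<bullet> \<gamma> u) s - 2 * (nderiv S (Suc j) \<gamma> s \<bullet> c) + 0) (at s within S)"
    by (intro has_vector_derivative_add has_vector_derivative_diff has_vector_derivative_const
        has_vector_derivative_nderiv[OF perfect smooth_curve_inner_self Suc.prems]
        has_vector_derivative_nderiv[OF perfect smooth Suc.prems]
        bounded_linear.has_vector_derivative[OF bounded_linear_mult_right]
        bounded_linear.has_vector_derivative[OF bounded_linear_inner_left])
  then show ?case
    using nderiv_Suc_eqI[OF perfect Suc.prems Suc.IH] by simp
qed

lemma nderiv_2_inner_self:
  assumes "s \<in> S"
  shows "nderiv S 2 (\<lambda>u. \<gamma> u \<bullet> \<gamma> u) s
       = 2 * (nderiv S 2 \<gamma> s \<bullet> \<gamma> s) + 2 * (nderiv S 1 \<gamma> s \<bullet> nderiv S 1 \<gamma> s)"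
proof -
  have D: "(nderiv S j \<gamma> has_vector_derivative nderiv S (Suc j) \<gamma> u) (at u within S)" if "u \<in> S" for u j
    by (rule has_vector_derivative_nderiv[OF perfect smooth that])
  have 1: "nderiv S (Suc 0) (\<lambda>u. \<gamma> u \<bullet> \<gamma> u) u = \<gamma> u \<bullet> nderiv S 1 \<gamma> u + nderiv S 1 \<gamma> u \<bullet> \<gamma> u"
    if "u \<in> S" for u
    using bounded_bilinear.has_vector_derivative[OF bounded_bilinear_inner D D, of u 0 0] that
    by (intro nderiv_Suc_eqI[OF perfect]) auto
  have "nderiv S (Suc (Suc 0)) (\<lambda>u. \<gamma> u \<bullet> \<gamma> u) s
      = (\<gamma> s \<bullet> nderiv S (Suc 1) \<gamma> s + nderiv S 1 \<gamma> s \<bullet> nderiv S 1 \<gamma> s)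
      + (nderiv S 1 \<gamma> s \<bullet> nderiv S 1 \<gamma> s + nderiv S (Suc 1) \<gamma> s \<bullet> \<gamma> s)"
    using D[OF assms, of 0] D[OF assms, of 1] assms
    by (intro nderiv_Suc_eqI[OF perfect _ 1] has_vector_derivative_add
        bounded_bilinear.has_vector_derivative[OF bounded_bilinear_inner]) auto
  then show ?thesis
    by (simp add: inner_commute numeral_2_eq_2)
qed

text \<open>Order 0 fixes the radius and the higher orders form a linear system for
  \<open>c\<close>. Positivity of the radius comes for free from that system.\<close>

lemma osculating_sphere_iff:
  assumes "s \<in> S"
  shows "osculating_sphere m S \<gamma> s c r \<longleftrightarrow> r = dist (\<gamma> s) c \<and>
    (\<forall>j\<in>{1..m+1}. nderiv S j \<gamma> s \<bullet> c = nderiv S j (\<lambda>u. \<gamma> u \<bullet> \<gamma> u) s / 2)"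
    (is "?L \<longleftrightarrow> _ \<and> ?E")
proof -
  have L: "?L \<longleftrightarrow> r > 0 \<and> (dist (\<gamma> s) c)\<^sup>2 = r\<^sup>2 \<and> ?E"
  proof -
    have "(\<forall>j\<le>m+1. P j) \<longleftrightarrow> P 0 \<and> (\<forall>j\<in>{1..m+1}. P j)" for P :: "nat \<Rightarrow> bool"
      by (metis One_nat_def Suc_leI atLeastAtMost_iff gr0I le0)
    moreover have "nderiv S j (\<lambda>u. (dist (\<gamma> u) c)\<^sup>2 - r\<^sup>2) s = 0
      \<longleftrightarrow> nderiv S j \<gamma> s \<bullet> c = nderiv S j (\<lambda>u. \<gamma> u \<bullet> \<gamma> u) s / 2" if "j \<in> {1..m+1}" for j
      using that unfolding nderiv_sphere_equation[OF assms] by auto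
    ultimately show ?thesis
      unfolding osculating_sphere_def by (simp add: Ball_def)
  qed
  \<comment> \<open>With centre \<open>\<gamma> s\<close>, the equation for \<open>j = 2\<close>,
    available since \<open>m \<ge> 1\<close>, would force the first derivative of
    \<open>\<gamma>\<close> to vanish.\<close>
  have "c \<noteq> \<gamma> s" if ?E
  proof
    assume "c = \<gamma> s"
    with that m have "nderiv S 2 \<gamma> s \<bullet> \<gamma> s = nderiv S 2 (\<lambda>u. \<gamma> u \<bullet> \<gamma> u) s / 2"
      by auto
    then have "nderiv S 1 \<gamma> s = 0"
      using nderiv_2_inner_self[OF assms] by simp
    moreover have "nderiv S 1 \<gamma> s \<noteq> 0"
      using generic_indep(2)[OF assms] dependent_zero by (metis atLeastAtMost_iff image_eqI le_add2 order_refl)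
    ultimately show False by simp
  qed
  then have "dist (\<gamma> s) c > 0" if ?E
    using that by auto
  moreover have "r > 0 \<and> d\<^sup>2 = r\<^sup>2 \<longleftrightarrow> r = d" if "d > 0" for d :: real
    using that by (auto dest: power2_eq_imp_eq)
  ultimately show ?thesis
    unfolding L by blast
qed

text \<open>The system has as many independent equations as dimensions, so the smooth solution is
  the only one and is what \<open>THE\<close> selects.\<close>

lemma Ck_on_focal_curve: "Ck_on n S (focal_curve m S \<gamma>)"
proof -
  let ?b = "\<lambda>j s. nderiv S j (\<lambda>u. \<gamma> u \<bullet> \<gamma> u) s * (1/2)"
  have b: "Ck_on n S (?b j)" for n j
    using smooth_curve_nderiv[OF perfect smooth_curve_inner_self] smooth_curve_iff_Ck_on[OF perfect]
    by (intro Ck_on_mult Ck_on_const) blast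
  obtain c where c: "\<And>n. Ck_on n S c"
      "\<And>s j. s \<in> S \<Longrightarrow> j \<in> {1..m+1} \<Longrightarrow> nderiv S j \<gamma> s \<bullet> c s = ?b j s"
    using linear_system_smooth_solution[of "m + 1" S "\<lambda>j. nderiv S j \<gamma>" ?b]
      Ck_on_nderiv_curve generic_indep b by blast
  have "c s = focal_curve m S \<gamma> s" if s: "s \<in> S" for s
  proof -
    have *: "(\<exists>r. osculating_sphere m S \<gamma> s x r) \<longleftrightarrow> (\<forall>j\<in>{1..m+1}. nderiv S j \<gamma> s \<bullet> x = ?b j s)" for x
      by (simp add: osculating_sphere_iff[OF s])
    have "x = c s" if "\<exists>r. osculating_sphere m S \<gamma> s x r" for x
      using orthogonal_independent_family_eq_0[of "\<lambda>j. nderiv S j \<gamma> s" "x - c s"]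
        generic_indep[OF s] that c(2)[OF s] unfolding * dim by (simp add: inner_diff_right)
    then show ?thesis
      unfolding focal_curve_def using c(2)[OF s] * by (intro the_equality[symmetric]) blast+
  qed
  with c(1) show ?thesis by (rule Ck_on_cong)
qed

lemma Ck_on_focal_curvature: "i \<le> m \<Longrightarrow> Ck_on n S (focal_curvature m S \<gamma> i)"
  unfolding focal_curvature_def[abs_def]
  using Ck_on_nderiv_curve[of n 0]
  by (intro Ck_on_inner Ck_on_diff Ck_on_focal_curve Ck_on_frenet_frame) auto

lemma continuous_on_frenet_curvature: "continuous_on S (frenet_curvature S \<gamma> m)"
proof -
  have "Ck_on 0 S (\<lambda>s. nderiv S 1 (frenet_normal S \<gamma> (m - 1)) s \<bullet> frenet_normal S \<gamma> m s)"
    using m by (intro Ck_on_inner Ck_on_nderiv_1[OF perfect] Ck_on_frenet_frame) auto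
  then show ?thesis
    by (simp add: frenet_curvature_def[abs_def])
qed

text \<open>
  Differentiating \<open>\<gamma>\<^sup>(\<^sup>i\<^sup>) \<bullet> n\<^sub>m = 0\<close> for \<open>i \<le> m\<close> shows that \<open>n\<^sub>m'\<close> is orthogonal to \<open>V\<^sub>j\<close> for
  \<open>j < m\<close>, and that \<open>\<kappa>\<^sub>m\<close> is the quotient of the last two Gram--Schmidt residuals.
\<close>

lemma frenet_curvature_last_pos:
  assumes s: "s \<in> S"
  shows "frenet_curvature S \<gamma> m s > 0"
proof -
  let ?D = "\<lambda>j. nderiv S j \<gamma>" and ?V = "frenet_frame S \<gamma>"
  let ?r = "\<lambda>k. norm (gram_schmidt_residual (\<lambda>j. ?D j s) k)"
  have r: "?r k > 0" if "k \<in> {1..m+1}" for k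
    using gram_schmidt_residual_neq_0[OF generic_indep[OF s]] that by simp
  have dV: "(?V k has_vector_derivative nderiv S 1 (?V k) s) (at s within S)" if "k \<in> {1..m+1}" for k
    using has_vector_derivative_nderiv[OF perfect _ s, of "?V k" 0] Ck_on_frenet_frame[OF that]
    by (simp add: smooth_curve_iff_Ck_on[OF perfect])
  have zero: "x' \<bullet> ?V (m+1) s + x s \<bullet> nderiv S 1 (?V (m+1)) s = 0"
    if "\<And>u. u \<in> S \<Longrightarrow> x u \<bullet> ?V (m+1) u = 0" and "(x has_vector_derivative x') (at s within S)" for x x'
  proof -
    have "((\<lambda>u. x u \<bullet> ?V (m+1) u) has_vector_derivative
        x s \<bullet> nderiv S 1 (?V (m+1)) s + x' \<bullet> ?V (m+1) s) (at s within S)"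
      using bounded_bilinear.has_vector_derivative[OF bounded_bilinear_inner that(2) dV[of "m+1"]] by simp
    moreover have "((\<lambda>u. x u \<bullet> ?V (m+1) u) has_vector_derivative 0) (at s within S)"
      by (rule has_vector_derivative_transform[OF s _ has_vector_derivative_const]) (rule that(1))
    ultimately show ?thesis
      using vector_derivative_within[OF perfect[OF s]] by (metis add.commute)
  qed
  \<comment> \<open>Differentiation raises \<open>i\<close> to \<open>Suc i\<close>, and by
    triangularity this derivative meets the last frame vector only if
    \<open>Suc i = m + 1\<close>.\<close>
  have D: "?D i s \<bullet> nderiv S 1 (?V (m+1)) s = - (if i = m then ?r (m+1) else 0)" if "i \<in> {1..m}" for i
  proof -
    have "?D i u \<bullet> ?V (m+1) u = 0" if "u \<in> S" for u
      using inner_vector_gram_schmidt[OF generic_indep[OF that], of i "m+1"] \<open>i \<in> {1..m}\<close>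
      by (simp add: frenet_frame_def)
    from zero[OF this has_vector_derivative_nderiv[OF perfect smooth s]]
    have "?D (Suc i) s \<bullet> ?V (m+1) s + ?D i s \<bullet> nderiv S 1 (?V (m+1)) s = 0" .
    moreover have "?D (Suc i) s \<bullet> ?V (m+1) s = (if i = m then ?r (m+1) else 0)"
      using inner_vector_gram_schmidt[OF generic_indep[OF s], of "Suc i" "m+1"] that
      by (auto simp: frenet_frame_def)
    ultimately show ?thesis by simp
  qed
  have V: "?V i s \<bullet> nderiv S 1 (?V (m+1)) s = 0" if "i \<in> {1..<m}" for i
    unfolding frenet_frame_def[of S \<gamma> i s] inner_commute[of "gram_schmidt _ _"]
    using D that by (intro inner_gram_schmidt_eq_0) (auto simp: inner_commute)
  have "?D m s \<bullet> nderiv S 1 (?V (m+1)) s = ?r m * (?V m s \<bullet> nderiv S 1 (?V (m+1)) s)"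
  proof -
    have "?D m s = ?r m *\<^sub>R ?V m s + (\<Sum>i\<in>{1..<m}. (?D m s \<bullet> ?V i s) *\<^sub>R ?V i s)"
      unfolding frenet_frame_def by (rule gram_schmidt_decomp)
    from arg_cong[OF this, of "\<lambda>x. x \<bullet> nderiv S 1 (?V (m+1)) s"]
    have "?D m s \<bullet> nderiv S 1 (?V (m+1)) s = ?r m * (?V m s \<bullet> nderiv S 1 (?V (m+1)) s)
        + (\<Sum>i\<in>{1..<m}. (?D m s \<bullet> ?V i s) * (?V i s \<bullet> nderiv S 1 (?V (m+1)) s))"
      by (simp only: inner_add_left inner_scaleR_left inner_sum_left)
    also have "(\<Sum>i\<in>{1..<m}. (?D m s \<bullet> ?V i s) * (?V i s \<bullet> nderiv S 1 (?V (m+1)) s)) = 0"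
      using V by (intro sum.neutral) auto
    finally show ?thesis by simp
  qed
  moreover have "nderiv S 1 (?V m) s \<bullet> ?V (m+1) s + ?V m s \<bullet> nderiv S 1 (?V (m+1)) s = 0"
    using m by (intro zero dV) (simp_all add: inner_frenet_frame)
  \<comment> \<open>Here \<open>?V m\<close> is the normal numbered \<open>m - 1\<close>, so
    \<open>\<kappa>\<^sub>m\<close> is \<open>nderiv S 1 (?V m) s \<bullet> ?V (m+1) s\<close>, the
    negative of \<open>?V m s \<bullet> nderiv S 1 (?V (m+1)) s\<close>.\<close>
  ultimately have "?r (m+1) = ?r m * frenet_curvature S \<gamma> m s"
    using D[of m] m by (simp add: frenet_curvature_def algebra_simps add_eq_0_iff)
  then show ?thesis
    using r[of m] r[of "m+1"] m by (simp add: zero_less_mult_iff)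
qed

lemma continuous_on_focal_speed:
  "continuous_on S (\<lambda>s. nderiv S 1 (focal_curvature m S \<gamma> m) s
     + focal_curvature m S \<gamma> (m - 1) s * frenet_curvature S \<gamma> m s)"
proof -
  have "continuous_on S (nderiv S 1 (focal_curvature m S \<gamma> m))"
    using Ck_on_nderiv_1[OF perfect Ck_on_focal_curvature[of m "Suc 0"]] by simp
  moreover have "continuous_on S (focal_curvature m S \<gamma> (m - 1))"
    using Ck_on_focal_curvature[of "m - 1" 0] by simp
  ultimately show ?thesis
    using continuous_on_frenet_curvature by (intro continuous_intros)
qed

end

section \<open>Constant signs and orientation of frames\<close>

text \<open>The image of \<open>S\<close> is an interval that misses 0.\<close>

lemma sgn_constant_on_connected:
  fixes f :: "'a::topological_space \<Rightarrow> real"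
  assumes "connected S" and "continuous_on S f" and "\<And>s. s \<in> S \<Longrightarrow> f s \<noteq> 0"
  obtains a where "a \<in> {-1, 1}" "\<And>s. s \<in> S \<Longrightarrow> sgn (f s) = a"
proof -
  have "is_interval (f ` S)"
    using assms(1,2) by (simp add: is_interval_connected_1 connected_continuous_image)
  moreover have "0 \<notin> f ` S"
    using assms(3) by auto
  ultimately have "\<not> (f x < 0 \<and> f y > 0)" if "x \<in> S" "y \<in> S" for x y
    using that unfolding is_interval_1 by (meson imageI less_imp_le)
  then have "(\<forall>s\<in>S. f s > 0) \<or> (\<forall>s\<in>S. f s < 0)"
    using assms(3) by (meson linorder_neqE_linordered_idom)
  with that show ?thesis
    by (metis insert_iff sgn_1_neg sgn_1_pos)
qed

text \<open>The constant sign is absorbed into the axis: \<open>a *\<^sub>R U\<close> replaces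
  \<open>U\<close>, and the angle stays the same.\<close>

lemma slant_helix_signed:
  assumes "slant_helix S V k" and "a \<in> {-1, 1}" and "\<And>s. s \<in> S \<Longrightarrow> W l s = a *\<^sub>R V k s"
  shows "slant_helix S W l"
proof -
  obtain U \<theta> where U: "norm U = 1" "0 \<le> \<theta>" "\<theta> \<le> pi" "\<theta> \<noteq> pi / 2" "\<And>s. s \<in> S \<Longrightarrow> U \<bullet> V k s = cos \<theta>"
    using assms(1) unfolding slant_helix_def by auto
  have "norm (a *\<^sub>R U) = 1" "\<And>s. s \<in> S \<Longrightarrow> (a *\<^sub>R U) \<bullet> W l s = cos \<theta>"
    using assms(2,3) U by auto
  with U show ?thesis
    unfolding slant_helix_def by blast
qed

text \<open>The rank is strictly increasing, hence injective between sets of equal size. So the rows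
  in \<open>positive_basis\<close> are the frame vectors, each occurring once.\<close>

lemma index_rank_bij:
  "bij_betw (\<lambda>i::'n::{finite,linorder}. card {j. j \<le> i}) UNIV {1..CARD('n)}"
proof -
  have less: "card {j. j \<le> i} < card {j. j \<le> k}" if "i < k" for i k :: 'n
    using that by (intro psubset_card_mono) (auto simp: psubset_eq set_eq_iff dest: leD)
  have inj: "inj (\<lambda>i::'n. card {j. j \<le> i})"
    by (rule linorder_injI) (rule less_imp_neq[OF less])
  moreover have "range (\<lambda>i::'n. card {j. j \<le> i}) \<subseteq> {1..CARD('n)}"
    by (auto simp: Suc_le_eq card_gt_0_iff intro!: card_mono)
  ultimately show ?thesis
    unfolding bij_betw_def by (simp add: card_subset_eq card_image)
qed

lemma det_orthonormal_family_neq_0: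
  fixes B :: "nat \<Rightarrow> real ^ 'n::{finite,linorder}"
  assumes "\<And>i k. i \<in> {1..CARD('n)} \<Longrightarrow> k \<in> {1..CARD('n)} \<Longrightarrow> B i \<bullet> B k = (if i = k then 1 else 0)"
  shows "det (\<chi> i. B (card {j. j \<le> i})) \<noteq> 0"
proof -
  let ?M = "(\<chi> i. B (card {j. j \<le> i})) :: real ^ 'n::{finite,linorder} ^ 'n::{finite,linorder}"
  have "row i ?M = B (card {j. j \<le> i})" for i
    by (simp add: row_def vec_eq_iff)
  moreover have "card {j. j \<le> i} \<in> {1..CARD('n)}" for i :: 'n
    using index_rank_bij bij_betwE by blast
  ultimately have "orthogonal_matrix ?M"
    using assms bij_betw_imp_inj_on[OF index_rank_bij[where 'n = 'n]]
    unfolding orthogonal_matrix_orthonormal_rows orthogonal_def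
    by (auto simp: norm_eq_1 dest: injD)
  then show ?thesis
    using det_orthogonal_matrix by fastforce
qed

theorem theorem7:
  fixes \<gamma> :: "real \<Rightarrow> real ^ 'n::{finite,linorder}" and S :: "real set" and m :: nat
  assumes "CARD('n) = m + 1" and "m \<ge> 1"
    and "is_interval S" and "interior S \<noteq> {}"
    and "regular_curve S \<gamma>" and "generic_curve m S \<gamma>" and "arclength_param S \<gamma>"
    and "focal_frame_well_defined m S \<gamma>"
  shows "(slant_helix S (frenet_frame S \<gamma>) 1 \<longrightarrow> slant_helix S (focal_frame m S \<gamma>) (m + 1)) \<and>
         (slant_helix S (frenet_frame S \<gamma>) (m + 1) \<longrightarrow> slant_helix S (focal_frame m S \<gamma>) 1) \<and>
         (\<forall>k. 2 \<le> k \<and> k \<le> m \<and> slant_helix S (frenet_frame S \<gamma>) k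
              \<longrightarrow> slant_helix S (focal_frame m S \<gamma>) (m - k + 2))"
proof -
  let ?V = "frenet_frame S \<gamma>" and ?B = "\<lambda>i s. focal_frame_with_sign 1 m S \<gamma> i s"
  note perfect = at_within_interval_neq_bot[OF assms(3,4)]
  have dim: "DIM(real ^ 'n::{finite,linorder}) = m + 1"
    using assms(1) by simp
  have smooth: "smooth_curve S \<gamma>"
    using assms(5) by (simp add: regular_curve_def)
  note curve = perfect dim assms(2) smooth assms(6)
  have connected: "connected S"
    using assms(3) by (rule is_interval_connected)
  obtain e where e: "e \<in> {-1, 1}" "\<And>s. s \<in> S \<Longrightarrow> focal_eps m S \<gamma> s = e"
    using sgn_constant_on_connected[OF connected continuous_on_focal_speed[OF curve]] assms(8)
    unfolding focal_frame_well_defined_def focal_eps_def by (auto simp: sgn_zero_iff)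
  have delta: "focal_delta m S \<gamma> l s = (-1) ^ l * e" if "s \<in> S" for l s
    using frenet_curvature_last_pos[OF curve that] e(1) e(2)[OF that]
    by (auto simp: focal_delta_def sgn_mult power_sgn)
  \<comment> \<open>The signs of the trial frame \<open>?B\<close>; the final 1 is its sign of
    \<open>t\<close>, correct or not for orientation.\<close>
  define a where "a = (\<lambda>k. if k = 1 then e else if k \<le> m then (-1) ^ (k - 1) * e else 1)"
  have a: "a k \<in> {-1, 1}" for k
    using e(1) by (cases "even (k - 1)") (auto simp: a_def)
  have B: "?B k s = a k *\<^sub>R ?V (m + 2 - k) s" if "s \<in> S" "k \<in> {1..m+1}" for k s
  proof -
    have "m - (k - 1) + 1 = m + 2 - k"
      using that(2) by auto
    moreover have "k = m + 1" if "\<not> k \<le> m"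
      using that \<open>k \<in> {1..m+1}\<close> by simp
    ultimately show ?thesis
      using that e(2) delta assms(2) by (auto simp: focal_frame_with_sign_def a_def)
  qed
  have cV: "continuous_on S (?V k)" if "k \<in> {1..m+1}" for k
    using Ck_on_frenet_frame[OF curve that, of 0] by simp
  have cB: "continuous_on S (?B k)" if "k \<in> {1..m+1}" for k
  proof -
    have "continuous_on S (\<lambda>s. a k *\<^sub>R ?V (m + 2 - k) s)"
      using that by (intro continuous_on_scaleR continuous_on_const cV) auto
    then show ?thesis
      by (subst continuous_on_cong[OF refl B[OF _ that]])
  qed
  \<comment> \<open>The sign of this determinant decides the case distinction in
    \<open>focal_frame\<close>.\<close>
  define d where "d = (\<lambda>s. det (\<chi> i. ?B (card {j. j \<le> i}) s))"
  have "continuous_on S d"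
    unfolding d_def det_def
    using cB assms(1) index_rank_bij[where 'n = 'n, THEN bij_betwE]
    by (auto intro!: continuous_intros continuous_on_vec_lambda)
  moreover have "d s \<noteq> 0" if s: "s \<in> S" for s
    unfolding d_def
  proof (rule det_orthonormal_family_neq_0)
    fix i k assume "i \<in> {1..CARD('n)}" "k \<in> {1..CARD('n)}"
    then have ik: "i \<in> {1..m+1}" "k \<in> {1..m+1}"
      by (simp_all only: assms(1))
    then have "?V (m + 2 - i) s \<bullet> ?V (m + 2 - k) s = (if i = k then 1 else 0)"
      by (subst inner_frenet_frame[OF curve s]) auto
    then show "?B i s \<bullet> ?B k s = (if i = k then 1 else 0)"
      using a[of i] a[of k] ik by (auto simp: B[OF s])
  qed
  ultimately obtain p where p: "\<And>s. s \<in> S \<Longrightarrow> sgn (d s) = p"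
    using sgn_constant_on_connected[OF connected] by blast
  have pos: "positive_basis (\<lambda>i. ?B i s) \<longleftrightarrow> p = 1" if "s \<in> S" for s
    using sgn_1_pos[of "d s"] unfolding p[OF that] by (simp add: positive_basis_def d_def)
  define \<sigma> :: real where "\<sigma> = (if p = 1 then 1 else - 1)"
  have \<sigma>: "\<sigma> \<in> {-1, 1}"
    "\<And>k s. s \<in> S \<Longrightarrow> focal_frame m S \<gamma> k s = focal_frame_with_sign \<sigma> m S \<gamma> k s"
    by (auto simp: \<sigma>_def focal_frame_def pos)
  \<comment> \<open>The reversal \<open>k \<mapsto> m + 2 - k\<close> is an involution of
    \<open>{1..m+1}\<close>, so this one statement covers all three parts.\<close>
  have main: "slant_helix S (focal_frame m S \<gamma>) k"
    if "slant_helix S ?V (m + 2 - k)" "k \<in> {1..m+1}" for k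
  proof (rule slant_helix_signed[OF that(1)])
    show "(if k \<le> m then a k else \<sigma>) \<in> {-1, 1}"
      using a \<sigma>(1) by simp
    show "focal_frame m S \<gamma> k s = (if k \<le> m then a k else \<sigma>) *\<^sub>R ?V (m + 2 - k) s" if "s \<in> S" for s
      using B[OF that \<open>k \<in> {1..m+1}\<close>] \<sigma>(2)[OF that] \<open>k \<in> {1..m+1}\<close> assms(2)
      by (cases "k = m + 1") (auto simp: focal_frame_with_sign_def)
  qed
  show ?thesis
  proof (intro conjI allI impI)
    fix k assume k: "2 \<le> k \<and> k \<le> m \<and> slant_helix S ?V k"
    then have "m + 2 - (m - k + 2) = k"
      by auto
    with k main[of "m - k + 2"] show "slant_helix S (focal_frame m S \<gamma>) (m - k + 2)"
      by auto
  qed (use main[of "m + 1"] main[of 1] in auto)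
qed

end
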